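(* Let $G$ be a connected $2n$-vertex $d$-regular $\lambda$-bi-expander with color classes $V_0$ and $V_1$, and let $v_0\in V_0$. For every $f\in\mathrm{Hom}_{v_0}(G)$ there exist $i\in\{0,1\}$ and $k\in\mathbb{Z}$ such that $$\big|\{v\in V_i : f(v)\ne k\}\big|\le\frac{2\lambda n}{d}.\qquad( * )$$ Let $i^*\in\{0,1\}$ be the smallest $i$ for which there exists a $k$ satisfying $( * )$ with $V_i$. Denote by $\mathrm{phase}(f)$ the smallest $k$ satisfying $( * )$ for $i=i^*$. The parity of $\mathrm{phase}(f)$ is $i^*$ (that is, $\mathrm{phase}(f)\equiv i^*\pmod 2$). Moreover, if $\lambda<d/3$, then $$\big|\{v\in V(G): |f(v)-\mathrm{phase}(f)|\ge2\}\big|\le\frac{3\lambda n}{d}.$$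
   Context: Graphs are finite, simple and undirected. For a graph $G$ and $v_0\in V(G)$, $\mathrm{Hom}_{v_0}(G)$ is the set of all $f:V(G)\to\mathbb{Z}$ with $f(v_0)=0$ and $|f(u)-f(v)|=1$ for every edge $\{u,v\}$ of $G$. For $S,T\subseteq V(G)$, $e(S,T)$ is the number of pairs $(a,b)\in S\times T$ with $\{a,b\}\in E(G)$. A $d$-regular bipartite graph $G$ with $2n$ vertices and color classes $V_0,V_1$ is a $\lambda$-bi-expander if $\left|e(S,T)-\frac dn|S||T|\right|\le\lambda\sqrt{|S||T|}$ for all $S\subseteq V_0$ and $T\subseteq V_1$.
   Formalization: For λ ≥ d/2 every integer k satisfies ( * ), so phase(f) does not exist; the parity claim is therefore stated for the case where the smallest k exists, and that it exists is proved whenever λ < d/2. *)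

theory Defs
  imports
    Complex_Main
    "HOL-Library.FuncSet"
    "HOL-Number_Theory.Cong"
    "Graph_Theory.Digraph_Component"
begin

text \<open>
  A finite simple undirected graph is a \<open>pair_graph\<close>: a finite loop-free digraph without parallel
  arcs whose arc relation is symmetric.  An edge between \<open>u\<close> and \<open>v\<close> is the pair of arcs
  \<open>(u, v)\<close>, \<open>(v, u)\<close>, so the degree of a vertex is its out-degree.
\<close>

text \<open>Functions on the vertex set are encoded as functions that are \<open>undefined\<close> outside of it.\<close>

definition Hom :: "'a \<Rightarrow> 'a pair_pre_digraph \<Rightarrow> ('a \<Rightarrow> int) set" where
  "Hom v0 G = {f \<in> pverts G \<rightarrow>\<^sub>E UNIV. f v0 = 0 \<and> (\<forall>(u, v) \<in> parcs G. \<bar>f u - f v\<bar> = 1)}"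

definition regular :: "'a pair_pre_digraph \<Rightarrow> nat \<Rightarrow> bool" where
  "regular G d \<longleftrightarrow> (\<forall>v \<in> pverts G. out_degree (with_proj G) v = d)"

text \<open>The colour classes are \<open>V 0\<close> and \<open>V 1\<close>; other values of \<open>V\<close> are irrelevant.\<close>

definition color_classes :: "'a pair_pre_digraph \<Rightarrow> (nat \<Rightarrow> 'a set) \<Rightarrow> bool" where
  "color_classes G V \<longleftrightarrow>
     V 0 \<union> V 1 = pverts G \<and> V 0 \<inter> V 1 = {} \<and>
     (\<forall>(u, v) \<in> parcs G. (u \<in> V 0 \<and> v \<in> V 1) \<or> (u \<in> V 1 \<and> v \<in> V 0))"

definition edge_count :: "'a pair_pre_digraph \<Rightarrow> 'a set \<Rightarrow> 'a set \<Rightarrow> nat" where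
  "edge_count G S T = card {(a, b) \<in> S \<times> T. (a, b) \<in> parcs G}"

definition bi_expander ::
    "'a pair_pre_digraph \<Rightarrow> (nat \<Rightarrow> 'a set) \<Rightarrow> nat \<Rightarrow> nat \<Rightarrow> real \<Rightarrow> bool" where
  "bi_expander G V n d lam \<longleftrightarrow>
     pair_graph G \<and> card (pverts G) = 2 * n \<and> regular G d \<and> color_classes G V \<and>
     (\<forall>S T. S \<subseteq> V 0 \<longrightarrow> T \<subseteq> V 1 \<longrightarrow>
        \<bar>real (edge_count G S T) - real d / real n * real (card S) * real (card T)\<bar>
          \<le> lam * sqrt (real (card S) * real (card T)))"

definition near_const ::
    "(nat \<Rightarrow> 'a set) \<Rightarrow> nat \<Rightarrow> nat \<Rightarrow> real \<Rightarrow> ('a \<Rightarrow> int) \<Rightarrow> nat \<Rightarrow> int \<Rightarrow> bool" where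
  "near_const V n d lam f i k \<longleftrightarrow>
     real (card {v \<in> V i. f v \<noteq> k}) \<le> 2 * lam * real n / real d"

definition i_star :: "(nat \<Rightarrow> 'a set) \<Rightarrow> nat \<Rightarrow> nat \<Rightarrow> real \<Rightarrow> ('a \<Rightarrow> int) \<Rightarrow> nat" where
  "i_star V n d lam f = (LEAST i. i \<in> {0, 1} \<and> (\<exists>k. near_const V n d lam f i k))"

text \<open>
  A set of integers need not have a least element: for \<open>lam \<ge> d / 2\<close> every \<open>k\<close> satisfies
  \<open>near_const\<close>, and \<open>phase\<close>, being a \<open>LEAST\<close> over the integers, is then an unspecified value.
  The predicate \<open>phase_defined\<close> says that the least element exists.
\<close>

definition phase_defined :: "(nat \<Rightarrow> 'a set) \<Rightarrow> nat \<Rightarrow> nat \<Rightarrow> real \<Rightarrow> ('a \<Rightarrow> int) \<Rightarrow> bool" where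
  "phase_defined V n d lam f \<longleftrightarrow>
     (\<exists>k. near_const V n d lam f (i_star V n d lam f) k \<and>
          (\<forall>k'. near_const V n d lam f (i_star V n d lam f) k' \<longrightarrow> k \<le> k'))"

definition phase :: "(nat \<Rightarrow> 'a set) \<Rightarrow> nat \<Rightarrow> nat \<Rightarrow> real \<Rightarrow> ('a \<Rightarrow> int) \<Rightarrow> int" where
  "phase V n d lam f = (LEAST k. near_const V n d lam f (i_star V n d lam f) k)"

end

theory Submission
  imports Defs
begin

text \<open>
  Write \<open>m = lam * n / d\<close>.  If no edge joins \<open>S \<subseteq> V 0\<close> to \<open>T \<subseteq> V 1\<close>, the expander inequality reads
  \<open>(d / n) * |S| * |T| \<le> lam * sqrt (|S| * |T|)\<close>, so that \<open>|S| * |T| \<le> m\<^sup>2\<close> and one of the two sets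
  has at most \<open>m\<close> elements (\<open>no_edges_imp_small\<close>).  Everything else follows from this by choosing
  \<open>S\<close> and \<open>T\<close> according to the values of \<open>f\<close>: since \<open>f\<close> changes by exactly 1 along an edge,
  vertices whose values are equal or at least 2 apart are never adjacent.  Both classes have \<open>n\<close>
  vertices, because each meets all the edges and every vertex lies on \<open>d > 0\<close> of them; and \<open>f\<close> has
  the parity \<open>i\<close> on \<open>V i\<close>, because its parity alternates along the walks that leave \<open>v0\<close>.

  \<^item> Existence of \<open>k\<close>.  If \<open>n \<le> 2 * m\<close> there is nothing to do.  Otherwise let \<open>k\<close> be the threshold
    level of \<open>V 0\<close>: at most \<open>m\<close> of its vertices have a value below \<open>k\<close>, more than \<open>m\<close> have
    a value up to \<open>k\<close>; let \<open>l\<close> be that of \<open>V 1\<close>.  The two levels differ because they have different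
    parities.  If, say, \<open>k < l\<close>, the more than \<open>m\<close> vertices of \<open>V 0\<close> with value at most \<open>k\<close> are
    nonadjacent to the vertices of \<open>V 1\<close> with value above \<open>l\<close>.  So at most \<open>m\<close> vertices of \<open>V 1\<close> lie
    above \<open>l\<close>, and at most \<open>m\<close> below (\<open>near_level_exists\<close>).

  \<^item> The phase.  When \<open>2 * m < n\<close>, every \<open>k\<close> that satisfies the bound on \<open>V i\<close> is a value of \<open>f\<close> on
    \<open>V i\<close>; hence there are finitely many such \<open>k\<close>, so that a least one exists, and they have the
    parity \<open>i\<close>.  When \<open>n \<le> 2 * m\<close>, every integer satisfies the bound, and there is no least one.

  \<^item> The deviation bound.  Let \<open>p\<close> be the phase and \<open>i\<close> its class.  At most \<open>2 * m\<close> vertices of \<open>V i\<close>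
    have a value other than \<open>p\<close>.  If \<open>3 * m < n\<close>, more than \<open>m\<close> vertices of \<open>V i\<close> have the value \<open>p\<close>;
    none of them is adjacent to a vertex of the other class whose value is at least 2 away from \<open>p\<close>,
    so there are at most \<open>m\<close> of the latter.
\<close>

section \<open>Threshold levels of integer-valued functions\<close>

text \<open>
  The level is the least value \<open>k\<close> of \<open>f\<close> for which \<open>{v \<in> A. f v \<le> k}\<close> has more than \<open>m\<close> elements.
  Choosing it among the values that \<open>f\<close> takes on \<open>A\<close> is what later separates the levels of two
  classes on which \<open>f\<close> takes different values.
\<close>

lemma threshold_level_exists:
  fixes f :: "'a \<Rightarrow> int" and m :: real
  assumes fin: "finite A" and m: "0 \<le> m" "m < card A"
  obtains k where "k \<in> f ` A" "card {v \<in> A. f v < k} \<le> m" "m < card {v \<in> A. f v \<le> k}"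
proof -
  define K where "K = {k \<in> f ` A. m < card {v \<in> A. f v \<le> k}}"
  have "A \<noteq> {}" using m by auto
  have "{v \<in> A. f v \<le> Max (f ` A)} = A" using fin by auto
  then have "m < card {v \<in> A. f v \<le> Max (f ` A)}" using m by simp
  moreover have "Max (f ` A) \<in> f ` A" using fin \<open>A \<noteq> {}\<close> by (intro Max_in) auto
  ultimately have "K \<noteq> {}" unfolding K_def by blast
  have "finite K" using fin by (auto simp: K_def)
  then have MinK: "Min K \<in> K" using \<open>K \<noteq> {}\<close> by simp
  have below: "card {v \<in> A. f v < Min K} \<le> m"
  proof (cases "{v \<in> A. f v < Min K} = {}")
    case True
    show ?thesis unfolding True using m by simp
  next
    case False
    \<comment> \<open>The largest value below \<open>Min K\<close> has the same lower set and is not in \<open>K\<close>.\<close>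
    define j where "j = Max (f ` {v \<in> A. f v < Min K})"
    have "j \<in> f ` {v \<in> A. f v < Min K}"
      unfolding j_def using fin False by (intro Max_in) auto
    then have j: "j \<in> f ` A" "j < Min K" by auto
    have upper: "f v \<le> j" if "v \<in> A" "f v < Min K" for v
      unfolding j_def using fin that by (intro Max_ge) auto
    have "{v \<in> A. f v \<le> j} = {v \<in> A. f v < Min K}"
      using j upper by auto
    moreover have "j \<notin> K" using j \<open>finite K\<close> by (meson Min_le not_less)
    ultimately show ?thesis using j by (auto simp: K_def)
  qed
  show thesis by (rule that[of "Min K"]) (use MinK below in \<open>auto simp: K_def\<close>)
qed

lemma card_differing_le_of_card_sides_le:
  fixes f :: "'a \<Rightarrow> int" and m :: real
  assumes "finite A" "card {v \<in> A. f v < k} \<le> m" "card {v \<in> A. f v > k} \<le> m"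
  shows "card {v \<in> A. f v \<noteq> k} \<le> 2 * m"
proof -
  have "{v \<in> A. f v \<noteq> k} = {v \<in> A. f v < k} \<union> {v \<in> A. f v > k}" by auto
  then have "card {v \<in> A. f v \<noteq> k} \<le> card {v \<in> A. f v < k} + card {v \<in> A. f v > k}"
    by (simp add: card_Un_le)
  with assms show ?thesis by linarith
qed

text \<open>
  The larger of the two threshold levels is the one wanted: few vertices of its own class lie below it
  by its choice, and few lie above it because many vertices of the other class lie below it.
\<close>

lemma near_level_exists:
  fixes f :: "'a \<Rightarrow> int" and m :: real
  assumes fin: "finite A" "finite B" and m: "0 \<le> m" "m < card A" "m < card B"
    and disj: "f ` A \<inter> f ` B = {}"
    and AB: "\<And>k. card {v \<in> A. f v < k} \<le> m \<or> card {v \<in> B. f v > k} \<le> m"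
    and BA: "\<And>k. card {v \<in> B. f v < k} \<le> m \<or> card {v \<in> A. f v > k} \<le> m"
  shows "\<exists>k. card {v \<in> A. f v \<noteq> k} \<le> 2 * m \<or> card {v \<in> B. f v \<noteq> k} \<le> 2 * m"
proof -
  have larger: "card {v \<in> Y. f v \<noteq> l} \<le> 2 * m"
    if "finite X" "finite Y" "k < l" "m < card {v \<in> X. f v \<le> k}" "card {v \<in> Y. f v < l} \<le> m"
      and XY: "\<And>k. card {v \<in> X. f v < k} \<le> m \<or> card {v \<in> Y. f v > k} \<le> m"
    for X Y k l
  proof -
    \<comment> \<open>At \<open>l\<close>, the class \<open>X\<close> already has more than \<open>m\<close> vertices below, so \<open>Y\<close> has few above.\<close>
    have "card {v \<in> X. f v \<le> k} \<le> card {v \<in> X. f v < l}"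
      using that by (intro card_mono) auto
    then have "card {v \<in> Y. f v > l} \<le> m" using XY[of l] that by linarith
    then show ?thesis using that by (intro card_differing_le_of_card_sides_le)
  qed
  obtain k where k: "k \<in> f ` A" "card {v \<in> A. f v < k} \<le> m" "m < card {v \<in> A. f v \<le> k}"
    using threshold_level_exists[OF fin(1) m(1,2)] .
  obtain l where l: "l \<in> f ` B" "card {v \<in> B. f v < l} \<le> m" "m < card {v \<in> B. f v \<le> l}"
    using threshold_level_exists[OF fin(2) m(1,3)] .
  have "k \<noteq> l" using k l disj by auto
  then consider "k < l" | "l < k" by linarith
  then show ?thesis
  proof cases
    case 1
    then show ?thesis using larger[OF fin 1 k(3) l(2) AB] by blast
  next
    case 2
    then show ?thesis using larger[OF fin(2,1) 2 l(3) k(2) BA] by blast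
  qed
qed

section \<open>Connected regular bipartite graphs\<close>

lemma connected_imp_reachable:
  assumes "pair_graph G" "Digraph_Component.connected (with_proj G)"
    and "u \<in> pverts G" "v \<in> pverts G"
  shows "u \<rightarrow>\<^sup>*\<^bsub>with_proj G\<^esub> v"
proof -
  interpret pair_graph G by fact
  have "strongly_connected (with_proj G)"
    using sym_arcs assms(2) by (rule symmetric_connected_imp_strongly_connected)
  then show ?thesis using assms by (auto simp: strongly_connected_def)
qed

lemma color_class_subset: "color_classes G V \<Longrightarrow> i \<in> {0, 1} \<Longrightarrow> V i \<subseteq> pverts G"
  by (auto simp: color_classes_def)

lemma Hom_parity:
  assumes "pair_graph G" "Digraph_Component.connected (with_proj G)"
    and col: "color_classes G V" and v0: "v0 \<in> V 0" and f: "f \<in> Hom v0 G"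
    and i: "i \<in> {0, 1}" and v: "v \<in> V i"
  shows "[f v = int i] (mod 2)"
proof -
  interpret pair_graph G by fact
  have "v0 \<in> pverts G" "v \<in> pverts G" using col v0 i v color_class_subset by blast+
  then have "v0 \<rightarrow>\<^sup>*\<^bsub>with_proj G\<^esub> v" using assms(1,2) by (simp add: connected_imp_reachable)
  then have "(v \<in> V 0 \<longrightarrow> f v mod 2 = 0) \<and> (v \<in> V 1 \<longrightarrow> f v mod 2 = 1)"
  proof (induction rule: reachable_induct)
    case base
    then show ?case using f v0 col by (auto simp: Hom_def color_classes_def)
  next
    case (step x y)
    then have xy: "(x, y) \<in> parcs G" by simp
    then have "\<bar>f x - f y\<bar> = 1" using f by (auto simp: Hom_def)
    then have "f y mod 2 = (f x + 1) mod 2" by presburger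
    moreover have "x \<in> V 0 \<and> y \<in> V 1 \<and> y \<notin> V 0 \<or> x \<in> V 1 \<and> y \<in> V 0 \<and> y \<notin> V 1"
      using xy col by (auto simp: color_classes_def)
    moreover have "(f x + 1) mod 2 = 1" if "f x mod 2 = 0" using that by presburger
    moreover have "(f x + 1) mod 2 = 0" if "f x mod 2 = 1" using that by presburger
    ultimately show ?case using step.IH by auto
  qed
  then show ?thesis using i v by (auto simp: cong_def)
qed

lemma connected_regular_degree_pos:
  assumes pg: "pair_graph G" and conn: "Digraph_Component.connected (with_proj G)"
    and reg: "regular G d" and two: "card (pverts G) \<ge> 2"
  shows "d > 0"
proof (rule ccontr)
  interpret pair_graph G by fact
  assume "\<not> d > 0"
  have no_arcs: "(u, v) \<notin> parcs G" for u v
  proof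
    assume uv: "(u, v) \<in> parcs G"
    then have "u \<in> pverts G" by (rule in_arcsD1)
    then have "card (out_arcs (with_proj G) u) = 0"
      using reg \<open>\<not> d > 0\<close> by (simp add: regular_def out_degree_def)
    moreover have "(u, v) \<in> out_arcs (with_proj G) u" using uv by simp
    ultimately show False using finite_out_arcs by (metis card_0_eq empty_iff)
  qed
  have "u = v" if "u \<rightarrow>\<^sup>*\<^bsub>with_proj G\<^esub> v" for u v
    using that by (induction rule: reachable_induct) (auto simp: no_arcs)
  then have "\<forall>u \<in> pverts G. \<forall>v \<in> pverts G. u = v"
    using connected_imp_reachable[OF pg conn] by blast
  then have "card (pverts G) \<le> 1" by (simp add: card_le_Suc0_iff_eq)
  then show False using two by simp
qed

lemma card_arcs_from_regular:
  assumes "pair_graph G" "regular G d" "S \<subseteq> pverts G"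
  shows "card {e \<in> parcs G. fst e \<in> S} = d * card S"
proof -
  interpret pair_graph G by fact
  have fin: "finite S" using assms(3) pair_finite_verts by (rule finite_subset)
  have "{e \<in> parcs G. fst e \<in> S} = (\<Union>v\<in>S. out_arcs (with_proj G) v)" by auto
  then have "card {e \<in> parcs G. fst e \<in> S} = (\<Sum>v\<in>S. card (out_arcs (with_proj G) v))"
    using fin by (simp add: card_UN_disjoint out_arcs_def disjoint_iff)
  also have "\<dots> = (\<Sum>v\<in>S. d)"
    using assms by (intro sum.cong) (auto simp: regular_def out_degree_def)
  finally show ?thesis by simp
qed

text \<open>Reversing the arcs matches those that leave \<open>V 0\<close> with those that leave \<open>V 1\<close>.\<close>

lemma card_color_class:
  assumes pg: "pair_graph G" and reg: "regular G d" and col: "color_classes G V"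
    and d: "d > 0" and card: "card (pverts G) = 2 * n" and i: "i \<in> {0, 1}"
  shows "card (V i) = n"
proof -
  interpret pair_graph G by fact
  have sym: "(u, v) \<in> parcs G \<Longrightarrow> (v, u) \<in> parcs G" for u v
    using pair_sym_arcs by (auto simp: symmetric_def sym_def)
  have "{e \<in> parcs G. fst e \<in> V 1} = prod.swap ` {e \<in> parcs G. fst e \<in> V 0}"
    using sym col by (fastforce simp: color_classes_def image_iff)
  then have "card {e \<in> parcs G. fst e \<in> V 1} = card {e \<in> parcs G. fst e \<in> V 0}"
    by (simp add: card_image)
  then have "card (V 0) = card (V 1)"
    using card_arcs_from_regular[OF pg reg] color_class_subset[OF col] d by simp
  moreover have "card (pverts G) = card (V 0) + card (V 1)"
    using col pair_finite_verts by (metis card_Un_disjoint color_classes_def finite_Un)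
  ultimately show ?thesis using card i by auto
qed

section \<open>Bi-expanders\<close>

lemma bi_expander_lam_nonneg:
  assumes exp: "bi_expander G V n d lam" and "v \<in> V 0" "w \<in> V 1"
  shows "0 \<le> lam"
proof -
  have "\<bar>real (edge_count G {v} {w}) - real d / real n * real (card {v}) * real (card {w})\<bar>
      \<le> lam * sqrt (real (card {v}) * real (card {w}))"
    using assms unfolding bi_expander_def by blast
  then show ?thesis by simp
qed

text \<open>
  Stated for \<open>V i\<close> and the opposite class \<open>V (1 - i)\<close>, because it is applied in both orientations
  while the expander inequality has \<open>S\<close> in \<open>V 0\<close>; the symmetry of the arcs bridges the two.
\<close>

lemma no_edges_imp_small:
  assumes exp: "bi_expander G V n d lam" and n: "n > 0" and d: "d > 0" and lam: "0 \<le> lam"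
    and i: "i \<in> {0, 1}" and S: "S \<subseteq> V i" and T: "T \<subseteq> V (1 - i)"
    and none: "\<And>a b. a \<in> S \<Longrightarrow> b \<in> T \<Longrightarrow> (a, b) \<notin> parcs G"
  shows "card S \<le> lam * n / d \<or> card T \<le> lam * n / d"
proof (rule ccontr)
  assume "\<not> ?thesis"
  then have large: "lam * n / d < card S" "lam * n / d < card T" by auto
  interpret pair_graph G using exp by (simp add: bi_expander_def)
  have sym: "(u, v) \<in> parcs G \<Longrightarrow> (v, u) \<in> parcs G" for u v
    using pair_sym_arcs by (auto simp: symmetric_def sym_def)
  have "{(a, b) \<in> S \<times> T. (a, b) \<in> parcs G} = {}" "{(a, b) \<in> T \<times> S. (a, b) \<in> parcs G} = {}"
    using none sym by auto
  then have e: "edge_count G S T = 0" "edge_count G T S = 0"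
    unfolding edge_count_def by (simp_all only: card.empty)
  define q where "q = real (card S) * real (card T)"
  have ineq: "real d / n * q \<le> lam * sqrt q"
  proof (cases "i = 0")
    case True
    then have "\<bar>real (edge_count G S T) - real d / n * card S * card T\<bar>
        \<le> lam * sqrt (real (card S) * card T)"
      using exp S T unfolding bi_expander_def by simp
    then show ?thesis by (simp add: e q_def)
  next
    case False
    then have "\<bar>real (edge_count G T S) - real d / n * card T * card S\<bar>
        \<le> lam * sqrt (real (card T) * card S)"
      using exp S T i unfolding bi_expander_def by simp
    then show ?thesis by (simp add: e q_def mult.commute mult.left_commute)
  qed
  have "0 \<le> lam * n / d" using lam by simp
  then have sq: "(lam * n / d)\<^sup>2 < q"
    unfolding power2_eq_square q_def using large by (intro mult_strict_mono) auto
  then have "q > 0" by (meson le_less_trans zero_le_power2)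
  then have "sqrt q * sqrt q = q" "sqrt q > 0" by simp_all
  then have "real d / n * sqrt q \<le> lam"
    using ineq by (metis mult.assoc mult_le_cancel_right_pos)
  then have "sqrt q \<le> lam * n / d" using n d by (simp add: field_simps)
  then have "q \<le> (lam * n / d)\<^sup>2" by (rule sqrt_le_D)
  with sq show False by simp
qed

section \<open>The phase of a homomorphism\<close>

text \<open>
  The value \<open>lam = d / 2\<close> separates two regimes: from there on the bound allows the whole class to
  differ from \<open>k\<close>, so no \<open>k\<close> is least; below it some vertex must have the value \<open>k\<close>, which makes
  \<open>k\<close> inherit the parity of the class and leaves only finitely many choices.
\<close>

lemma near_constI_large_lam:
  assumes "finite (V i)" "card (V i) = n" "d > 0" "real d / 2 \<le> lam"
  shows "near_const V n d lam f i k"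
proof -
  have "card {v \<in> V i. f v \<noteq> k} \<le> n" using assms card_mono[of "V i" "{v \<in> V i. f v \<noteq> k}"] by auto
  moreover have "real n \<le> 2 * lam * n / d"
    using assms mult_right_mono[of "real d / 2" lam "real n"] by (simp add: field_simps)
  ultimately show ?thesis unfolding near_const_def by linarith
qed

lemma near_const_imp_value:
  assumes "card (V i) = n" "n > 0" "d > 0" "lam < real d / 2" and near: "near_const V n d lam f i k"
  shows "k \<in> f ` V i"
proof (rule ccontr)
  assume "k \<notin> f ` V i"
  then have "{v \<in> V i. f v \<noteq> k} = V i" by auto
  then have "real n \<le> 2 * lam * n / d" using assms near by (simp add: near_const_def)
  moreover have "2 * lam * n / d < n" using assms by (simp add: field_simps)
  ultimately show False by simp
qed

lemma i_star_near_const: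
  assumes "\<exists>i \<in> {0, 1}. \<exists>k. near_const V n d lam f i k"
  shows "i_star V n d lam f \<in> {0, 1}" "\<exists>k. near_const V n d lam f (i_star V n d lam f) k"
proof -
  have "i_star V n d lam f \<in> {0, 1} \<and> (\<exists>k. near_const V n d lam f (i_star V n d lam f) k)"
    unfolding i_star_def by (rule LeastI_ex) (use assms in blast)
  then show "i_star V n d lam f \<in> {0, 1}" "\<exists>k. near_const V n d lam f (i_star V n d lam f) k"
    by blast+
qed

lemma phase_near_const:
  assumes "phase_defined V n d lam f"
  shows "near_const V n d lam f (i_star V n d lam f) (phase V n d lam f)"
proof -
  obtain k where k: "near_const V n d lam f (i_star V n d lam f) k"
      "\<And>k'. near_const V n d lam f (i_star V n d lam f) k' \<Longrightarrow> k \<le> k'"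
    using assms by (auto simp: phase_defined_def)
  then have "phase V n d lam f = k" unfolding phase_def by (rule Least_equality)
  with k show ?thesis by simp
qed

text \<open>
  The differing vertices of \<open>V i\<close> contribute at most \<open>2 * lam * n / d\<close>.  The remaining ones, with
  value \<open>k\<close>, are more than \<open>lam * n / d\<close> many because \<open>lam < d / 3\<close>.  No edge joins them to the far
  vertices of the opposite class, which are therefore at most \<open>lam * n / d\<close> many.
\<close>

lemma near_const_imp_few_far:
  assumes exp: "bi_expander G V n d lam" and n: "n > 0" and d: "d > 0" and lam: "0 \<le> lam"
    and f: "f \<in> Hom v0 G" and i: "i \<in> {0, 1}" and ci: "card (V i) = n"
    and lam3: "lam < real d / 3" and near: "near_const V n d lam f i k"
  shows "card {v \<in> pverts G. \<bar>f v - k\<bar> \<ge> 2} \<le> 3 * lam * n / d"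
proof -
  define m where "m = lam * n / d"
  interpret pair_graph G using exp by (simp add: bi_expander_def)
  have col: "color_classes G V" using exp by (simp add: bi_expander_def)
  define P where "P = {v \<in> V i. f v = k}"
  define Q where "Q = {v \<in> V i. f v \<noteq> k}"
  define W where "W = {v \<in> V (1 - i). \<bar>f v - k\<bar> \<ge> 2}"
  have i': "1 - i \<in> {0, 1}" using i by auto
  have fin: "finite (V i)" "finite (V (1 - i))"
    using color_class_subset[OF col i] color_class_subset[OF col i'] pair_finite_verts
    by (auto intro: finite_subset)
  have "V i = P \<union> Q" "P \<inter> Q = {}" by (auto simp: P_def Q_def)
  then have "n = card P + card Q" using ci fin by (metis card_Un_disjoint finite_Un)
  moreover have Q: "card Q \<le> 2 * m"
    using near by (simp add: near_const_def Q_def m_def mult.assoc)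
  moreover have "3 * m < n" using n d lam3 by (simp add: m_def field_simps)
  ultimately have P: "m < card P" by linarith
  have "card P \<le> m \<or> card W \<le> m"
    unfolding m_def
  proof (rule no_edges_imp_small[OF exp n d lam i])
    show "(a, b) \<notin> parcs G" if "a \<in> P" "b \<in> W" for a b
      using that f by (force simp: P_def W_def Hom_def)
  qed (auto simp: P_def W_def)
  then have W: "card W \<le> m" using P by simp
  have "{v \<in> pverts G. \<bar>f v - k\<bar> \<ge> 2} \<subseteq> Q \<union> W"
    using col i by (auto simp: color_classes_def Q_def W_def)
  then have "card {v \<in> pverts G. \<bar>f v - k\<bar> \<ge> 2} \<le> card (Q \<union> W)"
    using fin by (intro card_mono) (auto simp: Q_def W_def)
  also have "\<dots> \<le> card Q + card W" by (rule card_Un_le)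
  finally show ?thesis using Q W by (simp add: m_def)
qed

lemma Hom_near_const_exists:
  assumes exp: "bi_expander G V n d lam" and n: "n > 0" and d: "d > 0" and lam: "0 \<le> lam"
    and card: "card (V 0) = n" "card (V 1) = n" and f: "f \<in> Hom v0 G"
    and disj: "f ` V 0 \<inter> f ` V 1 = {}"
  shows "\<exists>i \<in> {0, 1}. \<exists>k. near_const V n d lam f i k"
proof (cases "lam < real d / 2")
  case True
  define m where "m = lam * n / d"
  have fin: "finite (V 0)" "finite (V 1)" using card n by (auto intro: card_ge_0_finite)
  have sides: "card {v \<in> V i. f v < k} \<le> m \<or> card {v \<in> V (1 - i). f v > k} \<le> m"
    if "i \<in> {0, 1}" for i k
    unfolding m_def
  proof (rule no_edges_imp_small[OF exp n d lam that])
    show "(a, b) \<notin> parcs G"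
      if "a \<in> {v \<in> V i. f v < k}" "b \<in> {v \<in> V (1 - i). f v > k}" for a b
      using that f by (force simp: Hom_def)
  qed auto
  have "0 \<le> m" using lam by (simp add: m_def)
  have "m \<le> 2 * m" using \<open>0 \<le> m\<close> by simp
  also have "2 * m < n" using True n d by (simp add: m_def field_simps)
  finally have "m < n" .
  then have "\<exists>k. card {v \<in> V 0. f v \<noteq> k} \<le> 2 * m \<or> card {v \<in> V 1. f v \<noteq> k} \<le> 2 * m"
    using near_level_exists[OF fin \<open>0 \<le> m\<close> _ _ disj] sides[of 0] sides[of 1] card by simp
  then show ?thesis by (auto simp: near_const_def m_def mult.assoc)
next
  case False
  then show ?thesis using near_constI_large_lam[of V 0 n d lam f] card n d
    by (auto intro: card_ge_0_finite)
qed

theorem lemma1p4: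
  fixes G :: "'a pair_pre_digraph" and V :: "nat \<Rightarrow> 'a set" and n d :: nat and lam :: real
    and v0 :: 'a and f :: "'a \<Rightarrow> int"
  assumes "bi_expander G V n d lam"
    and "Digraph_Component.connected (with_proj G)"
    and "v0 \<in> V 0"
    and "f \<in> Hom v0 G"
  shows "(\<exists>i \<in> {0, 1}. \<exists>k. near_const V n d lam f i k) \<and>
    (lam < real d / 2 \<longrightarrow> phase_defined V n d lam f) \<and>
    (phase_defined V n d lam f \<longrightarrow> [phase V n d lam f = int (i_star V n d lam f)] (mod 2)) \<and>
    (lam < real d / 3 \<longrightarrow>
      real (card {v \<in> pverts G. \<bar>f v - phase V n d lam f\<bar> \<ge> 2}) \<le> 3 * lam * real n / real d)"
proof -
  note exp = assms(1) and conn = assms(2) and v0 = assms(3) and f = assms(4)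
  have pg: "pair_graph G" and card: "card (pverts G) = 2 * n"
    and reg: "regular G d" and col: "color_classes G V"
    using exp by (auto simp: bi_expander_def)
  interpret pair_graph G by (rule pg)
  have "v0 \<in> pverts G" using v0 color_class_subset[OF col, of 0] by auto
  then have n: "n > 0" using card pair_finite_verts by (cases "n = 0") auto
  have d: "d > 0" using connected_regular_degree_pos[OF pg conn reg] card n by simp
  have cV: "card (V i) = n" if "i \<in> {0, 1}" for i
    using card_color_class[OF pg reg col d card that] .
  have fin: "finite (V i)" if "i \<in> {0, 1}" for i
    using cV[OF that] n by (auto intro: card_ge_0_finite)
  obtain w where "w \<in> V 1" using cV[of 1] n by fastforce
  then have lam: "0 \<le> lam" by (rule bi_expander_lam_nonneg[OF exp v0])
  have par: "[f v = int i] (mod 2)" if "i \<in> {0, 1}" "v \<in> V i" for i v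
    using Hom_parity[OF pg conn col v0 f that] .
  have "f ` V 0 \<inter> f ` V 1 = {}" using par[of 0] par[of 1] by (force simp: cong_def)
  then have ex: "\<exists>i \<in> {0, 1}. \<exists>k. near_const V n d lam f i k"
    using Hom_near_const_exists[OF exp n d lam _ _ f] cV by simp
  define i where "i = i_star V n d lam f"
  define p where "p = phase V n d lam f"
  have i: "i \<in> {0, 1}" and ex_i: "\<exists>k. near_const V n d lam f i k"
    using i_star_near_const[OF ex] by (simp_all add: i_def)
  have near_p: "near_const V n d lam f i p" if "phase_defined V n d lam f"
    using phase_near_const[OF that] by (simp add: i_def p_def)
  have defined: "phase_defined V n d lam f" if small: "lam < real d / 2"
  proof -
    have "{k. near_const V n d lam f i k} \<subseteq> f ` V i"
      using near_const_imp_value[of V i, OF cV[OF i] n d small] by blast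
    then have fin_k: "finite {k. near_const V n d lam f i k}"
      using fin[OF i] by (meson finite_imageI finite_subset)
    then have "Min {k. near_const V n d lam f i k} \<in> {k. near_const V n d lam f i k}"
      using ex_i by (intro Min_in) auto
    then show ?thesis
      unfolding phase_defined_def i_def[symmetric] using fin_k by (metis Min_le mem_Collect_eq)
  qed
  have parity: "[p = int i] (mod 2)" if def: "phase_defined V n d lam f"
  proof -
    have "lam < real d / 2"
    proof (rule ccontr)
      assume "\<not> lam < real d / 2"
      then have "near_const V n d lam f i k" for k
        using near_constI_large_lam[of V i, OF fin[OF i] cV[OF i] d] by simp
      then have "\<exists>k::int. \<forall>k'. k \<le> k'"
        using def by (auto simp: phase_defined_def i_def)
      then show False by (meson gt_ex lt_ex not_less)
    qed
    then have "p \<in> f ` V i" using near_const_imp_value[of V i, OF cV[OF i] n d _ near_p[OF def]] by simp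
    then show ?thesis using par[OF i] by auto
  qed
  have "card {v \<in> pverts G. \<bar>f v - p\<bar> \<ge> 2} \<le> 3 * lam * n / d" if lam3: "lam < real d / 3"
  proof -
    have "lam < real d / 2" using lam3 d by simp
    then show ?thesis
      using near_const_imp_few_far[OF exp n d lam f i] cV i lam3 near_p defined by blast
  qed
  then show ?thesis using ex defined parity by (simp add: i_def p_def)
qed

end
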